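(* Let $R$ be a commutative ring with identity containing $\mathbb{Q}$ and let $N\ge2$ be an integer. Let $p\in R[X_1,\ldots,X_N]$ be homogeneous. If $p$ has odd degree, then $\lambda_0(p)=0$. If $p=r$ is a constant in $R$, then $\lambda_0(r)=r$. If $p$ has even degree $2n\ge2$, then $$\lambda_0(p)=\frac{1}{n!\,2^n(2n+N-2)(2n+N-4)\cdots(2n+N-2n)}\,\Delta^np,$$ where the factors $2n+N-2j$, $j=1,\ldots,n$, go down by $2$ at each step, and $\Delta^np$, having degree $0$, is an element of $R$.
   Context: $\partial_j=\partial/\partial X_j$, $\Delta=\partial_1^2+\cdots+\partial_N^2$, and $M_{jk}=X_j\partial_k-X_k\partial_j$ for distinct $j,k\in\{1,\ldots,N\}$. $\lambda_0\colon R[X_1,\ldots,X_N]\to R$ denotes the unique $R$-linear map such that $\lambda_0\circ M_{jk}=0$ for all $j\ne k$ and $\lambda_0\bigl((X_1^2+\cdots+X_N^2)^n\bigr)=1$ for all integers $n\ge0$ (it exists and is unique). *)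

theory Defs
  imports Complex_Main "HOL-Library.Poly_Mapping" "HOL-Library.Cardinality"
begin

text \<open>
  The polynomial ring in \<open>N = CARD('n)\<close> variables indexed by the finite type \<open>'n\<close>, as the
  monoid algebra of exponent vectors; its ring operations are those of
  \<^theory>\<open>HOL-Library.Poly_Mapping\<close>.
\<close>

type_synonym ('n, 'r) mpoly = "('n \<Rightarrow>\<^sub>0 nat) \<Rightarrow>\<^sub>0 'r"

definition Const :: "'r::comm_ring_1 \<Rightarrow> ('n::finite, 'r) mpoly" where
  "Const r = Poly_Mapping.single 0 r"

definition X :: "'n \<Rightarrow> ('n::finite, 'r::comm_ring_1) mpoly" where
  "X j = Poly_Mapping.single (Poly_Mapping.single j 1) 1"

definition scale :: "'r::comm_ring_1 \<Rightarrow> ('n::finite, 'r) mpoly \<Rightarrow> ('n, 'r) mpoly" where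
  "scale r p = Const r * p"

text \<open>
  The truncated subtraction on exponents is harmless: where the exponent of \<open>j\<close> is zero,
  the coefficient vanishes.
\<close>

definition partial :: "'n \<Rightarrow> ('n::finite, 'r::comm_ring_1) mpoly \<Rightarrow> ('n, 'r) mpoly" where
  "partial j p = (\<Sum>m\<in>Poly_Mapping.keys p.
     Poly_Mapping.single (m - Poly_Mapping.single j 1)
       (of_nat (Poly_Mapping.lookup m j) * Poly_Mapping.lookup p m))"

definition laplacian :: "('n::finite, 'r::comm_ring_1) mpoly \<Rightarrow> ('n, 'r) mpoly" where
  "laplacian p = (\<Sum>j\<in>UNIV. partial j (partial j p))"

definition M :: "'n \<Rightarrow> 'n \<Rightarrow> ('n::finite, 'r::comm_ring_1) mpoly \<Rightarrow> ('n, 'r) mpoly" where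
  "M j k p = X j * partial k p - X k * partial j p"

text \<open>As usual, the zero polynomial is homogeneous of every degree.\<close>

definition homogeneous :: "nat \<Rightarrow> ('n::finite, 'r::comm_ring_1) mpoly \<Rightarrow> bool" where
  "homogeneous d p \<longleftrightarrow>
     (\<forall>m\<in>Poly_Mapping.keys p. (\<Sum>j\<in>UNIV. Poly_Mapping.lookup m j) = d)"

definition is_lambda0 :: "(('n::finite, 'r::comm_ring_1) mpoly \<Rightarrow> 'r) \<Rightarrow> bool" where
  "is_lambda0 l \<longleftrightarrow>
     module_hom scale (*) l \<and>
     (\<forall>j k p. j \<noteq> k \<longrightarrow> l (M j k p) = 0) \<and>
     (\<forall>n. l ((\<Sum>j\<in>UNIV. X j ^ 2) ^ n) = 1)"

text \<open>
  Meaningful when the coefficient ring contains the rationals and \<open>CARD('n) \<ge> 2\<close>: then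
  exactly one map satisfies \<^const>\<open>is_lambda0\<close>.
\<close>

definition lambda0 :: "('n::finite, 'r::comm_ring_1) mpoly \<Rightarrow> 'r" where
  "lambda0 = (THE l. is_lambda0 l)"

text \<open>An inclusion of the field of rationals as a unital subring.\<close>

definition rat_embedding :: "(rat \<Rightarrow> 'r::comm_ring_1) \<Rightarrow> bool" where
  "rat_embedding \<iota> \<longleftrightarrow> inj \<iota> \<and> \<iota> 1 = 1 \<and>
     (\<forall>x y. \<iota> (x + y) = \<iota> x + \<iota> y) \<and> (\<forall>x y. \<iota> (x * y) = \<iota> x * \<iota> y)"

lemma module_scale:
  "module (scale :: 'r::comm_ring_1 \<Rightarrow> ('n::finite, 'r) mpoly \<Rightarrow> ('n, 'r) mpoly)"
  by standard
    (simp_all add: scale_def Const_def single_add mult_single algebra_simps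
      flip: mult.assoc)

lemma partial_single:
  "partial j (Poly_Mapping.single m c) =
     Poly_Mapping.single (m - Poly_Mapping.single j 1) (of_nat (Poly_Mapping.lookup m j) * c)"
  by (cases "c = 0") (simp_all add: partial_def)

end

theory Submission
  imports Defs
begin

text \<open>
  Let \<open>E\<close> be the Euler operator. Modulo the images of the \<open>M j k\<close>, the operator \<open>|X|\<^sup>2 \<Delta>\<close>
  equals \<open>E (E + N - 2)\<close>, so \<open>l (|X|\<^sup>2 \<Delta> p) = d (d + N - 2) l p\<close> for every admissible \<open>l\<close> and
  every \<open>p\<close> homogeneous of degree \<open>d\<close>. As multiplication by \<open>|X|\<^sup>2\<close> commutes with the \<open>M j k\<close>,
  the map \<open>p \<mapsto> l (|X|\<^sup>2 p)\<close> is again admissible, and induction on the degree over all admissible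
  maps at once gives both the formula and uniqueness. Existence is witnessed by the means of
  monomials over the unit sphere, which are rational.
\<close>

section \<open>Polynomials and partial derivatives\<close>

lemma sum_monomials:
  "p = (\<Sum>m\<in>Poly_Mapping.keys p. Poly_Mapping.single m (Poly_Mapping.lookup p m))"
  by (rule poly_mapping_eqI) (auto simp: lookup_sum lookup_single when_def in_keys_iff)

text \<open>Lets identities that are additive in \<open>p\<close> be checked on monomials
  alone.\<close>

lemma mpoly_induct [case_names zero single add]:
  fixes p :: "('n::finite, 'r::comm_ring_1) mpoly"
  assumes "P 0" and "\<And>m c. P (Poly_Mapping.single m c)"
    and "\<And>p q. P p \<Longrightarrow> P q \<Longrightarrow> P (p + q)"
  shows "P p"
proof -
  have "P (\<Sum>m\<in>S. Poly_Mapping.single m (Poly_Mapping.lookup p m))" if "finite S" for S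
    using that by (induction S) (auto intro: assms)
  then show ?thesis by (metis finite_keys sum_monomials)
qed

lemma Const_of_nat: "Const (of_nat n) = of_nat n"
  by (simp add: Const_def)

lemma Const_mult: "Const (a * b) = Const a * Const b"
  by (simp add: Const_def mult_single)

lemma partial_add: "partial j (p + q) = partial j p + partial j q"
  unfolding partial_def
  by (rule setsum_keys_plus_distrib) (simp_all add: algebra_simps single_add)

lemma partial_zero: "partial j 0 = 0"
  by (simp add: partial_def)

lemma partial_sum: "partial j (\<Sum>a\<in>A. f a) = (\<Sum>a\<in>A. partial j (f a))"
  by (induction A rule: infinite_finite_induct) (simp_all add: partial_zero partial_add)

lemma partial_of_nat_mult: "partial j (of_nat n * p) = of_nat n * partial j p"
  by (induction n) (simp_all add: partial_zero partial_add algebra_simps)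

lemma X_mult_single:
  "X i * Poly_Mapping.single m c = Poly_Mapping.single (Poly_Mapping.single i 1 + m) c"
  by (simp add: X_def mult_single)

lemma single_add_minus:
  fixes m :: "'n \<Rightarrow>\<^sub>0 nat"
  assumes "Poly_Mapping.lookup m i \<noteq> 0"
  shows "Poly_Mapping.single i 1 + (m - Poly_Mapping.single i 1) = m"
  using assms by (intro poly_mapping_eqI) (auto simp: lookup_add lookup_minus lookup_single when_def)

text \<open>The Leibniz rule for one variable factor; it serves below as the commutation relation
  between \<open>partial j\<close> and multiplication by \<open>X i\<close>.\<close>

lemma partial_X_mult: "partial j (X i * p) = X i * partial j p + (if i = j then p else 0)"
proof (induction p rule: mpoly_induct)
  case (single m c)
  show ?case
  proof (cases "i = j")
    case True
    have "Poly_Mapping.single j (Suc 0) + (m - Poly_Mapping.single j (Suc 0)) = m"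
      if "Poly_Mapping.lookup m j \<noteq> 0"
      using single_add_minus[OF that] by simp
    with True show ?thesis
      \<comment> \<open>If \<open>X j\<close> does not occur in the monomial,
        \<open>partial j\<close> kills it and only the correction term survives; otherwise the
        truncated subtraction is undone.\<close>
      by (cases "Poly_Mapping.lookup m j = 0")
        (simp_all add: X_mult_single partial_single lookup_add algebra_simps single_add)
  next
    case False
    then have "Poly_Mapping.single i 1 + m - Poly_Mapping.single j 1
        = Poly_Mapping.single i 1 + (m - Poly_Mapping.single j 1)"
      by (intro poly_mapping_eqI) (auto simp: lookup_add lookup_minus lookup_single when_def)
    with False show ?thesis
      by (simp add: X_mult_single partial_single lookup_add lookup_single)
  qed
qed (simp_all add: partial_zero partial_add algebra_simps)

section \<open>Degrees\<close>

definition total_degree :: "('n::finite \<Rightarrow>\<^sub>0 nat) \<Rightarrow> nat" where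
  "total_degree m = (\<Sum>j\<in>UNIV. Poly_Mapping.lookup m j)"

lemma total_degree_add: "total_degree (m + m') = total_degree m + total_degree m'"
  by (simp add: total_degree_def lookup_add sum.distrib)

lemma total_degree_single: "total_degree (Poly_Mapping.single j a) = a"
  by (simp add: total_degree_def lookup_single when_def)

lemma homogeneous_iff: "homogeneous d p \<longleftrightarrow> (\<forall>m\<in>Poly_Mapping.keys p. total_degree m = d)"
  by (simp add: homogeneous_def total_degree_def)

lemma homogeneous_single: "homogeneous (total_degree m) (Poly_Mapping.single m c)"
  by (simp add: homogeneous_iff)

lemma homogeneous_sum:
  assumes "\<And>a. a \<in> A \<Longrightarrow> homogeneous d (f a)"
  shows "homogeneous d (\<Sum>a\<in>A. f a)"
  using keys_sum[of f A] assms by (fastforce simp: homogeneous_iff)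

lemma homogeneous_0_imp_Const:
  assumes "homogeneous 0 p"
  shows "p = Const (Poly_Mapping.lookup p 0)"
proof -
  have "m = 0" if "m \<in> Poly_Mapping.keys p" for m
    using that assms by (intro poly_mapping_eqI) (auto simp: homogeneous_def)
  then show ?thesis
    by (intro poly_mapping_eqI) (auto simp: Const_def lookup_single when_def in_keys_iff)
qed

lemma homogeneous_partial:
  assumes "homogeneous (Suc d) p"
  shows "homogeneous d (partial j p)"
  unfolding partial_def
proof (rule homogeneous_sum)
  fix m assume m: "m \<in> Poly_Mapping.keys p"
  have "total_degree (m - Poly_Mapping.single j 1) = d" if "Poly_Mapping.lookup m j \<noteq> 0"
    using arg_cong[OF single_add_minus[OF that], of total_degree] assms m
    by (auto simp: total_degree_add total_degree_single homogeneous_iff)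
  then show "homogeneous d (Poly_Mapping.single (m - Poly_Mapping.single j 1)
      (of_nat (Poly_Mapping.lookup m j) * Poly_Mapping.lookup p m))"
    by (cases "Poly_Mapping.lookup m j = 0") (simp_all add: homogeneous_iff)
qed

lemma partial_Const: "partial j (Const c) = 0"
  by (simp add: Const_def partial_single)

lemma partial_homogeneous_0:
  assumes "homogeneous 0 p"
  shows "partial j p = 0"
  using homogeneous_0_imp_Const[OF assms] by (metis partial_Const)

lemma homogeneous_laplacian:
  assumes "homogeneous (Suc (Suc d)) p"
  shows "homogeneous d (laplacian p)"
  unfolding laplacian_def using assms by (intro homogeneous_sum homogeneous_partial)

lemma laplacian_homogeneous_1:
  assumes "homogeneous (Suc 0) p"
  shows "laplacian p = 0"
  using homogeneous_partial[OF assms] by (simp add: laplacian_def partial_homogeneous_0)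

text \<open>Each \<open>X j * partial j\<close> acts on a monomial as multiplication by its exponent
  of \<open>j\<close>, and these exponents sum to the degree.\<close>

lemma Euler_identity:
  assumes "homogeneous d p"
  shows "(\<Sum>j\<in>UNIV. X j * partial j p) = of_nat d * p"
proof -
  have single: "X j * partial j (Poly_Mapping.single m c)
      = of_nat (Poly_Mapping.lookup m j) * Poly_Mapping.single m c" for j m and c :: 'b
    using single_add_minus[of m j]
    by (cases "Poly_Mapping.lookup m j = 0")
      (simp_all add: partial_single X_mult_single mult_single flip: single_of_nat)
  note p = sum_monomials[of p]
  have "(\<Sum>j\<in>UNIV. X j * partial j p) = (\<Sum>j\<in>UNIV. \<Sum>m\<in>Poly_Mapping.keys p.
      of_nat (Poly_Mapping.lookup m j) * Poly_Mapping.single m (Poly_Mapping.lookup p m))"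
    by (subst p) (simp add: partial_sum sum_distrib_left single)
  also have "\<dots> = (\<Sum>m\<in>Poly_Mapping.keys p.
      of_nat (total_degree m) * Poly_Mapping.single m (Poly_Mapping.lookup p m))"
    by (subst sum.swap) (simp add: total_degree_def sum_distrib_right)
  also have "\<dots> = of_nat d * p"
    using assms by (subst (3) p) (simp add: homogeneous_iff sum_distrib_left)
  finally show ?thesis .
qed

section \<open>Uniqueness and the Laplacian formula\<close>

abbreviation normsq :: "('n::finite, 'r::comm_ring_1) mpoly" where
  "normsq \<equiv> (\<Sum>j\<in>UNIV. X j ^ 2)"

lemma partial_normsq_mult: "partial j (normsq * p) = normsq * partial j p + 2 * X j * p"
proof -
  have *: "partial j (X i ^ 2 * p) = X i ^ 2 * partial j p + (if i = j then 2 * X j * p else 0)" for i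
    by (simp add: power2_eq_square mult.assoc partial_X_mult) (simp add: algebra_simps)
  show ?thesis
    by (simp add: sum_distrib_right partial_sum * sum.distrib)
qed

text \<open>Since \<open>partial j\<close> contributes \<open>2 * X j\<close> on
  \<open>normsq\<close>, the extra terms are \<open>X j * 2 * X k * p\<close> and
  \<open>X k * 2 * X j * p\<close>, which cancel.\<close>

lemma M_normsq_mult: "M j k (normsq * p) = normsq * M j k p"
  unfolding M_def partial_normsq_mult by (simp add: algebra_simps)

context
  fixes l :: "('n::finite, 'r::comm_ring_1) mpoly \<Rightarrow> 'r"
  assumes l: "is_lambda0 l"
begin

interpretation module_hom scale "(*)" l
  using l by (simp add: is_lambda0_def)

lemma is_lambda0_of_nat_mult: "l (of_nat d * p) = of_nat d * l p"
  using scale[of "of_nat d" p] by (simp add: scale_def Const_of_nat)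

lemma is_lambda0_Const: "l (Const r) = r"
proof -
  have "l ((\<Sum>j\<in>UNIV. X j ^ 2) ^ 0) = 1"
    using l unfolding is_lambda0_def by blast
  with scale[of r 1] show ?thesis by (simp add: scale_def)
qed

lemma is_lambda0_swap: "l (X j * partial k p) = l (X k * partial j p)"
proof (cases "j = k")
  case False
  with l have "l (M j k p) = 0" by (simp add: is_lambda0_def)
  then show ?thesis by (simp add: M_def diff)
qed simp

text \<open>Normalization persists because \<open>normsq * normsq ^ n\<close> is again a power of
  \<open>normsq\<close>. This closure is what allows an induction hypothesis to be applied to
  \<open>l (normsq * laplacian p)\<close>.\<close>

lemma is_lambda0_normsq_mult: "is_lambda0 (\<lambda>p. l (normsq * p))"
proof -
  have "scale c p = Const c * p" for c and p :: "('n, 'r) mpoly"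
    by (rule scale_def)
  then have "normsq * scale c p = scale c (normsq * p)" for c and p :: "('n, 'r) mpoly"
    by (simp only: mult.left_commute)
  with l show ?thesis
    unfolding is_lambda0_def module_hom_iff
    by (simp add: distrib_left flip: M_normsq_mult power_Suc)
qed

lemma is_lambda0_normsq_laplacian:
  assumes "homogeneous d p"
  shows "l (normsq * laplacian p) = of_nat d * (of_nat d + of_nat CARD('n) - 2) * l p"
proof -
  define E where "E j q = X j * partial j q" for j and q :: "('n, 'r) mpoly"
  have E_sum: "(\<Sum>j\<in>UNIV. E j p) = of_nat d * p"
    unfolding E_def by (rule Euler_identity[OF assms])
  \<comment> \<open>Write the argument as \<open>X k * partial j (X k * partial j p)\<close> plus a
    commutator, exchange the outer \<open>j\<close> and \<open>k\<close> under \<open>l\<close>, and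
    reorder into Euler summands. Each reordering costs one \<open>E j p\<close> on the diagonal,
    hence the factor 2.\<close>
  have *: "l (X k ^ 2 * partial j (partial j p))
      = l (E k (E j p)) + l (E j p) - (if j = k then 2 * l (E j p) else 0)" for j k
  proof -
    have "X k ^ 2 * partial j (partial j p)
        = X k * partial j (X k * partial j p) - (if j = k then E j p else 0)"
      by (simp add: partial_X_mult E_def power2_eq_square algebra_simps)
    moreover have "X j * partial k (X k * partial j p)
        = E k (E j p) + E j p - (if j = k then E j p else 0)"
      by (simp add: partial_X_mult E_def algebra_simps)
    ultimately show ?thesis
      using is_lambda0_swap[of k j "X k * partial j p"] by (simp add: diff add)
  qed
  have "l (normsq * laplacian p) = (\<Sum>j\<in>UNIV. \<Sum>k\<in>UNIV. l (X k ^ 2 * partial j (partial j p)))"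
    by (simp add: laplacian_def sum_distrib_left sum_distrib_right sum)
  \<comment> \<open>Summed over \<open>k\<close>, the middle term of \<open>*\<close> is counted N
    times and the diagonal term once, giving E E + N E - 2 E.\<close>
  also have "\<dots> = l (\<Sum>k\<in>UNIV. E k (\<Sum>j\<in>UNIV. E j p))
      + of_nat CARD('n) * l (\<Sum>j\<in>UNIV. E j p) - 2 * l (\<Sum>j\<in>UNIV. E j p)"
  proof -
    have "(\<Sum>j\<in>UNIV. \<Sum>k\<in>UNIV. l (E k (E j p))) = l (\<Sum>k\<in>UNIV. E k (\<Sum>j\<in>UNIV. E j p))"
      by (subst sum.swap) (simp add: sum E_def partial_sum sum_distrib_left)
    then show ?thesis
      by (simp add: * sum_subtractf sum.distrib sum sum_distrib_left)
  qed
  also have "\<dots> = l (of_nat d * (of_nat d * p)) + of_nat CARD('n) * l (of_nat d * p)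
      - 2 * l (of_nat d * p)"
  proof -
    have "E k (of_nat d * p) = of_nat d * E k p" for k
      unfolding E_def partial_of_nat_mult by (rule mult.left_commute)
    then show ?thesis by (simp only: E_sum flip: sum_distrib_left)
  qed
  also have "\<dots> = of_nat d * (of_nat d + of_nat CARD('n) - 2) * l p"
    by (simp only: is_lambda0_of_nat_mult) (simp only: ring_distribs mult_ac)
  finally show ?thesis .
qed

end

text \<open>Passing from degree \<open>2 * Suc i\<close> to \<open>2 * i\<close> contributes d (d +
  N - 2) with d = \<open>2 * Suc i\<close>, that is \<open>2 * Suc i * (2 * i + CARD('n))\<close>.
  The induction generalizes over \<open>l\<close>, which changes to \<open>l (normsq * _)\<close>.
  The multiplied-out form avoids division in the coefficient ring.\<close>

lemma is_lambda0_even: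
  fixes l :: "('n::finite, 'r::comm_ring_1) mpoly \<Rightarrow> 'r"
  assumes "is_lambda0 l" and "homogeneous (2 * n) p"
  shows "Const (of_nat (\<Prod>i<n. 2 * Suc i * (2 * i + CARD('n))) * l p) = (laplacian ^^ n) p"
  using assms
proof (induction n arbitrary: l p)
  case 0
  then obtain r where "p = Const r"
    using homogeneous_0_imp_Const[of p] by auto
  with 0 show ?case by (simp add: is_lambda0_Const)
next
  case (Suc n)
  define D where "D = (\<Prod>i<n. 2 * Suc i * (2 * i + CARD('n)))"
  have "Const (of_nat D * l (normsq * laplacian p)) = (laplacian ^^ n) (laplacian p)"
    unfolding D_def using Suc.prems
    by (intro Suc.IH is_lambda0_normsq_mult homogeneous_laplacian) simp_all
  moreover have "l (normsq * laplacian p) = of_nat (2 * Suc n * (2 * n + CARD('n))) * l p"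
    using is_lambda0_normsq_laplacian[OF Suc.prems] by (simp add: algebra_simps)
  ultimately show ?case
    unfolding prod.lessThan_Suc D_def[symmetric]
    by (simp add: funpow_swap1 mult.assoc del: mult_Suc_right mult_Suc)
qed

section \<open>Cancellation of positive integers, odd degrees and uniqueness\<close>

lemma rat_embedding_of_nat:
  assumes "rat_embedding \<iota>"
  shows "\<iota> (of_nat n) = of_nat n"
proof -
  have "\<iota> 0 + \<iota> 0 = \<iota> 0 + 0"
    using assms unfolding rat_embedding_def by (metis add_0_right)
  then have "\<iota> 0 = 0" by (simp only: add_left_cancel)
  with assms show ?thesis by (induction n) (simp_all add: rat_embedding_def)
qed

lemma rat_embedding_inverse:
  assumes "rat_embedding \<iota>" and "n > 0"
  shows "\<iota> (1 / of_nat n) * of_nat n = 1"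
proof -
  have "\<iota> (1 / of_nat n) * \<iota> (of_nat n) = \<iota> (1 / of_nat n * of_nat n)"
    using assms(1) unfolding rat_embedding_def by metis
  also have "\<dots> = 1"
    using assms by (simp add: rat_embedding_def)
  finally show ?thesis by (simp add: rat_embedding_of_nat[OF assms(1)])
qed

text \<open>The ring may have zero divisors, but positive integers are units in it.\<close>

lemma rat_embedding_cancel:
  fixes a b :: "'r::comm_ring_1"
  assumes "rat_embedding (\<iota> :: rat \<Rightarrow> 'r)" and "n > 0" and "of_nat n * a = of_nat n * b"
  shows "a = b"
  using arg_cong[OF assms(3), of "(*) (\<iota> (1 / of_nat n))"] rat_embedding_inverse[OF assms(1,2)]
  by (simp flip: mult.assoc)

text \<open>The same descent by two degrees ends in degree 1, where the Laplacian vanishes; every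
  factor passed on the way is a positive integer and cancels.\<close>

lemma is_lambda0_odd:
  fixes l :: "('n::finite, 'r::comm_ring_1) mpoly \<Rightarrow> 'r" and \<iota> :: "rat \<Rightarrow> 'r"
  assumes "rat_embedding \<iota>" and "CARD('n) \<ge> 2"
    and "is_lambda0 l" and "homogeneous (Suc (2 * n)) p"
  shows "l p = 0"
  using assms(3,4)
proof (induction n arbitrary: l p)
  case (Suc n)
  have "l (normsq * laplacian p) = 0"
    using Suc.prems by (intro Suc.IH is_lambda0_normsq_mult homogeneous_laplacian) simp_all
  moreover have "l (normsq * laplacian p)
      = of_nat ((2 * n + 3) * (2 * n + 1 + CARD('n))) * l p"
    using is_lambda0_normsq_laplacian[OF Suc.prems] by (simp add: algebra_simps)
  ultimately have "of_nat ((2 * n + 3) * (2 * n + 1 + CARD('n))) * l p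
      = of_nat ((2 * n + 3) * (2 * n + 1 + CARD('n))) * 0"
    by simp
  then show ?case by (rule rat_embedding_cancel[OF assms(1), rotated]) simp
next
  case 0
  then have "module_hom scale (*) l" by (simp add: is_lambda0_def)
  then have "l 0 = 0" by (rule module_hom.zero)
  \<comment> \<open>For d = 1 the factor d (d + N - 2) is N - 1, which is positive because N \<ge>
    2.\<close>
  then have "(of_nat CARD('n) - 1) * l p = 0"
    using is_lambda0_normsq_laplacian[OF 0] 0 by (simp add: laplacian_homogeneous_1)
  then have "of_nat (CARD('n) - 1) * l p = of_nat (CARD('n) - 1) * 0"
    using assms(2) by (simp add: of_nat_diff)
  then show ?case by (rule rat_embedding_cancel[OF assms(1), rotated]) (use assms(2) in simp)
qed

text \<open>By additivity it suffices to compare values on monomials. These are homogeneous, so the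
  even or the odd evaluation determines them.\<close>

lemma is_lambda0_unique:
  fixes l l' :: "('n::finite, 'r::comm_ring_1) mpoly \<Rightarrow> 'r" and \<iota> :: "rat \<Rightarrow> 'r"
  assumes \<iota>: "rat_embedding \<iota>" and N: "CARD('n) \<ge> 2"
    and l: "is_lambda0 l" and l': "is_lambda0 l'"
  shows "l = l'"
proof
  fix p
  have hom: "module_hom scale (*) l" "module_hom scale (*) l'"
    using l l' by (simp_all add: is_lambda0_def)
  show "l p = l' p"
  proof (induction p rule: mpoly_induct)
    case zero
    show ?case using hom by (simp add: module_hom.zero)
  next
    case (single m c)
    let ?p = "Poly_Mapping.single m c"
    show ?case
    proof (cases "even (total_degree m)")
      case True
      then obtain n where n: "total_degree m = 2 * n" by (rule evenE)
      define D where "D = (\<Prod>i<n. 2 * Suc i * (2 * i + CARD('n)))"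
      have hom_p: "homogeneous (2 * n) ?p" by (metis homogeneous_single n)
      have "Const (of_nat D * l ?p) = (Const (of_nat D * l' ?p) :: ('n, 'r) mpoly)"
        using is_lambda0_even[OF l hom_p] is_lambda0_even[OF l' hom_p] by (simp only: D_def)
      \<comment> \<open>\<open>Const\<close> is injective: the coefficient at exponent 0 recovers
        the scalar.\<close>
      then have "of_nat D * l ?p = of_nat D * l' ?p"
        unfolding Const_def by (metis lookup_single_eq)
      then show ?thesis
        by (rule rat_embedding_cancel[OF \<iota>, rotated]) (simp add: D_def prod_pos)
    next
      case False
      then obtain n where "total_degree m = Suc (2 * n)" by (auto elim: oddE)
      then have "homogeneous (Suc (2 * n)) ?p" by (metis homogeneous_single)
      then show ?thesis
        using is_lambda0_odd[OF \<iota> N] l l' by metis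
    qed
  next
    case (add p q)
    then show ?case using hom by (simp add: module_hom.add)
  qed
qed

section \<open>Existence\<close>

text \<open>
  The moments of a standard Gaussian variable; dividing their products by the moments of
  the squared radius gives the means of the monomials over the unit sphere.
  In odd degree \<open>radial_moment\<close> is only a nonzero placeholder, the numerator being zero there.
\<close>

fun gauss_moment :: "nat \<Rightarrow> nat" where
  "gauss_moment 0 = 1"
| "gauss_moment (Suc 0) = 0"
| "gauss_moment (Suc (Suc a)) = Suc a * gauss_moment a"

fun radial_moment :: "nat \<Rightarrow> nat \<Rightarrow> nat" where
  "radial_moment N 0 = 1"
| "radial_moment N (Suc 0) = 1"
| "radial_moment N (Suc (Suc d)) = (N + d) * radial_moment N d"

definition sphere_mean :: "('n::finite \<Rightarrow>\<^sub>0 nat) \<Rightarrow> rat" where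
  "sphere_mean m = of_nat (\<Prod>j\<in>UNIV. gauss_moment (Poly_Mapping.lookup m j))
     / of_nat (radial_moment CARD('n) (total_degree m))"

text \<open>The right-hand side is symmetric in \<open>j\<close> and \<open>k\<close>, which yields
  the vanishing on \<open>M j k\<close>. The Gaussian recursion absorbs the exponent produced by
  differentiation, and the total degree is unchanged.\<close>

lemma sphere_mean_rotate:
  fixes m :: "'n::finite \<Rightarrow>\<^sub>0 nat"
  assumes "j \<noteq> k"
  shows "of_nat (Poly_Mapping.lookup m k) *
      sphere_mean (Poly_Mapping.single j 1 + (m - Poly_Mapping.single k 1)) =
    of_nat (\<Prod>i\<in>UNIV - {j, k}. gauss_moment (Poly_Mapping.lookup m i)) *
      of_nat (gauss_moment (Suc (Poly_Mapping.lookup m j)) *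
        gauss_moment (Suc (Poly_Mapping.lookup m k)))
      / of_nat (radial_moment CARD('n) (total_degree m))"
proof (cases "Poly_Mapping.lookup m k")
  case 0
  \<comment> \<open>The right-hand side vanishes as well, since the first Gaussian moment is
    0.\<close>
  then show ?thesis by simp
next
  case (Suc a)
  let ?m = "Poly_Mapping.single j 1 + (m - Poly_Mapping.single k 1)"
  have "total_degree ?m = total_degree m"
    using arg_cong[OF single_add_minus[of m k], of total_degree] Suc
    by (simp add: total_degree_add total_degree_single)
  moreover have "(\<Prod>i\<in>UNIV. gauss_moment (Poly_Mapping.lookup ?m i))
      = (\<Prod>i\<in>insert j (insert k (UNIV - {j, k})). gauss_moment (Poly_Mapping.lookup ?m i))"
    by (rule prod.cong) auto
  moreover have "\<dots> = gauss_moment (Suc (Poly_Mapping.lookup m j)) * (gauss_moment a *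
      (\<Prod>i\<in>UNIV - {j, k}. gauss_moment (Poly_Mapping.lookup m i)))"
  proof -
    have "(\<Prod>i\<in>UNIV - {j, k}. gauss_moment (Poly_Mapping.lookup ?m i))
        = (\<Prod>i\<in>UNIV - {j, k}. gauss_moment (Poly_Mapping.lookup m i))"
      by (rule prod.cong) (auto simp: lookup_add lookup_minus lookup_single)
    with assms Suc show ?thesis
      by (simp add: lookup_add lookup_minus lookup_single)
  qed
  ultimately show ?thesis
    using Suc by (simp add: sphere_mean_def algebra_simps)
qed

text \<open>Raising exponent \<open>i\<close> by two multiplies the Gaussian product by the old
  exponent plus 1 and the radial moment by N + \<open>total_degree m\<close>. The former factors sum
  to the latter.\<close>

lemma sphere_mean_square:
  fixes m :: "'n::finite \<Rightarrow>\<^sub>0 nat"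
  shows "(\<Sum>i\<in>UNIV. sphere_mean (Poly_Mapping.single i 1 + (Poly_Mapping.single i 1 + m)))
    = sphere_mean m"
proof -
  let ?N = "CARD('n)"
  have "sphere_mean (Poly_Mapping.single i 1 + (Poly_Mapping.single i 1 + m))
      = of_nat (Suc (Poly_Mapping.lookup m i)) * (sphere_mean m / of_nat (?N + total_degree m))" for i
  proof -
    let ?m = "Poly_Mapping.single i 1 + (Poly_Mapping.single i 1 + m)"
    have "(\<Prod>j\<in>UNIV - {i}. gauss_moment (Poly_Mapping.lookup ?m j))
        = (\<Prod>j\<in>UNIV - {i}. gauss_moment (Poly_Mapping.lookup m j))"
      by (rule prod.cong) (auto simp: lookup_add lookup_single)
    then have "(\<Prod>j\<in>UNIV. gauss_moment (Poly_Mapping.lookup ?m j))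
        = Suc (Poly_Mapping.lookup m i) * (\<Prod>j\<in>UNIV. gauss_moment (Poly_Mapping.lookup m j))"
      by (simp add: prod.remove[of UNIV i] lookup_add lookup_single algebra_simps)
    moreover have "total_degree ?m = Suc (Suc (total_degree m))"
      by (simp add: total_degree_add total_degree_single)
    ultimately show ?thesis
      unfolding sphere_mean_def by (simp only: radial_moment.simps of_nat_mult) simp
  qed
  then have "(\<Sum>i\<in>UNIV. sphere_mean (Poly_Mapping.single i 1 + (Poly_Mapping.single i 1 + m)))
      = of_nat (\<Sum>i\<in>UNIV. Suc (Poly_Mapping.lookup m i)) *
        (sphere_mean m / of_nat (?N + total_degree m))"
    by (simp only: of_nat_sum sum_distrib_right)
  also have "(\<Sum>i\<in>UNIV. Suc (Poly_Mapping.lookup m i)) = ?N + total_degree m"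
    unfolding Suc_eq_plus1 by (simp only: sum.distrib) (simp add: total_degree_def)
  finally show ?thesis
    by (simp del: of_nat_add)
qed

lemma is_lambda0_exists:
  fixes \<iota> :: "rat \<Rightarrow> 'r::comm_ring_1"
  assumes \<iota>: "rat_embedding \<iota>"
  shows "\<exists>l :: ('n::finite, 'r) mpoly \<Rightarrow> 'r. is_lambda0 l"
proof -
  \<comment> \<open>The witness is the linear extension of the spherical means of monomials.\<close>
  define l :: "('n, 'r) mpoly \<Rightarrow> 'r" where
    "l p = (\<Sum>m\<in>Poly_Mapping.keys p. Poly_Mapping.lookup p m * \<iota> (sphere_mean m))" for p
  have \<iota>_add: "\<iota> (x + y) = \<iota> x + \<iota> y" and \<iota>_mult: "\<iota> (x * y) = \<iota> x * \<iota> y" and \<iota>_1: "\<iota> 1 = 1" for x y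
    using \<iota> by (simp_all add: rat_embedding_def)
  have \<iota>_of_nat: "\<iota> (of_nat n) = of_nat n" for n
    by (rule rat_embedding_of_nat[OF \<iota>])
  then have \<iota>_0: "\<iota> 0 = 0" by (metis of_nat_0)
  have \<iota>_sum: "\<iota> (\<Sum>i\<in>A. f i) = (\<Sum>i\<in>A. \<iota> (f i))" for A :: "'n set" and f
    by (induction A rule: infinite_finite_induct) (simp_all add: \<iota>_0 \<iota>_add)
  have l_single: "l (Poly_Mapping.single m c) = c * \<iota> (sphere_mean m)" for m c
    by (cases "c = 0") (simp_all add: l_def)
  have l_0: "l 0 = 0" by (simp add: l_def)
  have l_add: "l (p + q) = l p + l q" for p q
    unfolding l_def by (rule setsum_keys_plus_distrib) (simp_all add: algebra_simps)
  have l_sum: "l (\<Sum>i\<in>A. f i) = (\<Sum>i\<in>A. l (f i))" for A :: "'n set" and f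
    by (induction A rule: infinite_finite_induct) (simp_all add: l_0 l_add)
  have l_scale: "l (scale c p) = c * l p" for c p
  proof (induction p rule: mpoly_induct)
    case (single m a)
    have "scale c (Poly_Mapping.single m a) = Poly_Mapping.single m (c * a)"
      by (simp add: scale_def Const_def mult_single)
    then show ?case by (simp add: l_single mult.assoc)
  qed (simp_all add: scale_def l_0 l_add algebra_simps)
  have swap: "l (X j * partial k p) = l (X k * partial j p)" if "j \<noteq> k" for j k p
  proof (induction p rule: mpoly_induct)
    case (single m c)
    have eq: "l (X j * partial k (Poly_Mapping.single m c))
        = c * \<iota> (of_nat (Poly_Mapping.lookup m k) *
            sphere_mean (Poly_Mapping.single j 1 + (m - Poly_Mapping.single k 1)))" for j k
      by (simp add: partial_single X_mult_single l_single \<iota>_mult \<iota>_of_nat)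
    show ?case
      unfolding eq sphere_mean_rotate[OF that] sphere_mean_rotate[OF that[symmetric]]
      by (simp add: insert_commute mult.commute)
  qed (simp_all add: partial_zero partial_add l_0 l_add algebra_simps)
  have l_M: "l (M j k p) = 0" if "j \<noteq> k" for j k p
    using l_add[of "M j k p" "X k * partial j p"] swap[OF that] by (simp add: M_def)
  \<comment> \<open>On the unit sphere \<open>normsq\<close> is the constant 1; with
    \<open>l 1 = 1\<close> this gives the normalization on all its powers.\<close>
  have l_normsq: "l (normsq * p) = l p" for p
  proof (induction p rule: mpoly_induct)
    case (single m c)
    have "l (normsq * Poly_Mapping.single m c) = c * \<iota> (\<Sum>i\<in>UNIV.
        sphere_mean (Poly_Mapping.single i 1 + (Poly_Mapping.single i 1 + m)))"
      by (simp add: sum_distrib_right power2_eq_square mult.assoc X_mult_single l_sum l_single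
          \<iota>_sum sum_distrib_left)
    then show ?case by (simp only: sphere_mean_square l_single)
  qed (simp_all add: l_0 l_add algebra_simps)
  have "l 1 = 1"
    using l_single[of 0 1] by (simp add: sphere_mean_def total_degree_def \<iota>_1)
  then have "l (normsq ^ n) = 1" for n
    by (induction n) (simp_all add: l_normsq)
  moreover have "module ((*) :: 'r \<Rightarrow> 'r \<Rightarrow> 'r)"
    by standard (simp_all add: algebra_simps)
  ultimately have "is_lambda0 l"
    by (simp add: is_lambda0_def module_hom_iff module_scale l_add l_scale l_M)
  then show ?thesis by blast
qed

section \<open>The map \<open>lambda0\<close> and its closed formula\<close>

lemma is_lambda0_lambda0:
  fixes \<iota> :: "rat \<Rightarrow> 'r::comm_ring_1"
  assumes "rat_embedding \<iota>" and "CARD('n::finite) \<ge> 2"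
  shows "is_lambda0 (lambda0 :: ('n, 'r) mpoly \<Rightarrow> 'r)"
proof -
  obtain l :: "('n, 'r) mpoly \<Rightarrow> 'r" where "is_lambda0 l"
    using is_lambda0_exists[OF assms(1)] by blast
  then show ?thesis
    unfolding lambda0_def using is_lambda0_unique[OF assms] theI[of is_lambda0 l] by blast
qed

text \<open>Reindexing by i = n - j reverses the descending factors into \<open>2 * i + N\<close>,
  while the factors \<open>2 * Suc i\<close> collect to \<open>fact n * 2 ^ n\<close>.\<close>

lemma normalization_eq:
  "(fact n * 2 ^ n * (\<Prod>j=1..n. 2 * of_nat n + of_nat N - 2 * of_nat j) :: rat)
    = of_nat (\<Prod>i<n. 2 * Suc i * (2 * i + N))"
proof -
  have "(\<Prod>j=1..n. 2 * of_nat n + of_nat N - 2 * of_nat j :: rat)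
      = (\<Prod>i<n. of_nat (2 * i + N))"
    by (rule prod.reindex_bij_witness[of _ "\<lambda>i. n - i" "\<lambda>j. n - j"])
      (auto simp: of_nat_diff algebra_simps)
  moreover have "(\<Prod>i<n. of_nat (2 * Suc i * (2 * i + N)) :: rat)
      = fact n * 2 ^ n * (\<Prod>i<n. of_nat (2 * i + N))"
    by (induction n) (simp_all add: algebra_simps)
  ultimately show ?thesis
    by (simp only: of_nat_prod)
qed

theorem proposition4p6:
  fixes \<iota> :: "rat \<Rightarrow> 'r::comm_ring_1"
    and p :: "('n::finite, 'r) mpoly"
  assumes "rat_embedding \<iota>"
    and "CARD('n) \<ge> 2"
    and "\<exists>d. homogeneous d p"
  shows "(\<forall>d. odd d \<and> homogeneous d p \<longrightarrow> lambda0 p = 0) \<and>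
    (\<forall>r. p = Const r \<longrightarrow> lambda0 p = r) \<and>
    (\<forall>n\<ge>1. homogeneous (2 * n) p \<longrightarrow>
       Const (lambda0 p) =
         scale (\<iota> (1 / (fact n * 2 ^ n *
                     (\<Prod>j=1..n. 2 * of_nat n + of_nat CARD('n) - 2 * of_nat j))))
           ((laplacian ^^ n) p))"
proof (intro conjI allI impI)
  note l = is_lambda0_lambda0[OF assms(1,2)]
  show "lambda0 p = 0" if "odd d \<and> homogeneous d p" for d
    using that is_lambda0_odd[OF assms(1,2) l] by (auto elim!: oddE)
  show "lambda0 p = r" if "p = Const r" for r
    using is_lambda0_Const[OF l] that by simp
  fix n :: nat
  assume "homogeneous (2 * n) p"
  define D where "D = (\<Prod>i<n. 2 * Suc i * (2 * i + CARD('n)))"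
  have "D > 0" by (simp add: D_def prod_pos)
  have "(laplacian ^^ n) p = Const (of_nat D * lambda0 p)"
    using is_lambda0_even[OF l \<open>homogeneous (2 * n) p\<close>] by (simp only: D_def)
  \<comment> \<open>Scaling by the image of 1 / D solves the multiplied-out identity for
    \<open>lambda0 p\<close>.\<close>
  then have "scale (\<iota> (1 / of_nat D)) ((laplacian ^^ n) p)
      = Const (\<iota> (1 / of_nat D) * of_nat D * lambda0 p)"
    by (simp only: scale_def Const_mult mult.assoc)
  then show "Const (lambda0 p) =
      scale (\<iota> (1 / (fact n * 2 ^ n *
                  (\<Prod>j=1..n. 2 * of_nat n + of_nat CARD('n) - 2 * of_nat j))))
        ((laplacian ^^ n) p)"
    by (simp only: normalization_eq flip: D_def)
      (simp add: rat_embedding_inverse[OF assms(1) \<open>D > 0\<close>])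
qed

end
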